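(* Intuitionistic disjunction is not uniformly definable in propositional dependence logic $\mathbf{PD}$. That is, there is no context $\phi[r_1,r_2]$ for $\mathbf{PD}$ such that $\phi[\theta_1,\theta_2]\equiv \theta_1\vee\theta_2$ for all $\mathbf{PD}$-formulas $\theta_1,\theta_2$.
   Context: Fix a nonempty set $\mathrm{Prop}$ of propositional variables. Formulas of $\mathbf{PT}_0$ (propositional downward closed team logic) are given by $$\phi::= p\mid \neg p\mid \bot\mid {=}(p_1,\dots,p_k,q)\mid (\phi\wedge\phi)\mid(\phi\otimes\phi)\mid(\phi\vee\phi)\mid(\phi\to\phi),$$ with $p,p_i,q\in\mathrm{Prop}$. The formulas $p,\neg p,\bot$ and ${=}(p_1,\dots,p_k,q)$ (with $k\ge 0$) are atoms; in particular negation is not a connective. $\mathbf{PD}$-formulas are the $\mathbf{PT}_0$-formulas built from all these atoms using only $\wedge$ and $\otimes$. The connectives $\vee$ and $\to$ are called intuitionistic disjunction and intuitionistic implication. A team is a set $X$ of valuations $v:\mathrm{Prop}\to\{0,1\}$. Satisfaction $X\models\phi$: - $X\models p$ iff $v(p)=1$ for all $v\in X$; $X\models\neg p$ iff $v(p)=0$ for all $v\in X$; $X\models\bot$ iff $X=\emptyset$; - $X\models{=}(p_1,\dots,p_k,q)$ iff for all $v,v'\in X$, if $v(p_i)=v'(p_i)$ for all $i\le k$, then $v(q)=v'(q)$; - $X\models\phi\wedge\psi$ iff $X\models\phi$ and $X\models\psi$; - $X\models\phi\otimes\psi$ iff there are $Y,Z\subseteq X$ with $X=Y\cup Z$, $Y\models\phi$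 and $Z\models\psi$; - $X\models\phi\vee\psi$ iff $X\models\phi$ or $X\models\psi$; - $X\models\phi\to\psi$ iff for every team $Y\subseteq X$, $Y\models\phi$ implies $Y\models\psi$. $\phi\equiv\psi$ means that $X\models\phi\iff X\models\psi$ for all teams $X$. A context $\phi[r_1,\dots,r_m]$ for $\mathbf{PD}$ is a formula built using $\wedge,\otimes$ from the atoms of $\mathbf{PD}$ together with distinguished placeholder atoms $r_1,\dots,r_m$ (these are not allowed to occur negated or inside dependence atoms). For $\mathbf{PD}$-formulas $\theta_1,\dots,\theta_m$, $\phi[\theta_1,\dots,\theta_m]$ is the $\mathbf{PD}$-formula obtained by replacing every occurrence of each $r_i$ by $\theta_i$. *)

theory Defs
  imports Main
begin

text \<open>
  The nonempty set Prop of propositional variables is the type \<open>'p\<close>; every HOL type is nonempty,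
  and no assumption is made on its cardinality.
\<close>

type_synonym 'p valuation = "'p \<Rightarrow> bool"
type_synonym 'p team = "'p valuation set"

text \<open>\<open>Dep [p\<^sub>1, \<dots>, p\<^sub>k] q\<close> is the dependence atom \<open>=(p\<^sub>1, \<dots>, p\<^sub>k, q)\<close>, with \<open>k = 0\<close> allowed.\<close>

datatype 'p atom =
    Var 'p
  | NegVar 'p
  | Bot
  | Dep "'p list" 'p

datatype 'p pt0 =
    Atom "'p atom"
  | Conj "'p pt0" "'p pt0"
  | Tensor "'p pt0" "'p pt0"
  | IntDisj "'p pt0" "'p pt0"
  | IntImp "'p pt0" "'p pt0"

fun atom_sat :: "'p team \<Rightarrow> 'p atom \<Rightarrow> bool" where
  "atom_sat X (Var p) \<longleftrightarrow> (\<forall>v\<in>X. v p)"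
| "atom_sat X (NegVar p) \<longleftrightarrow> (\<forall>v\<in>X. \<not> v p)"
| "atom_sat X Bot \<longleftrightarrow> X = {}"
| "atom_sat X (Dep ps q) \<longleftrightarrow>
     (\<forall>v\<in>X. \<forall>v'\<in>X. (\<forall>p\<in>set ps. v p = v' p) \<longrightarrow> v q = v' q)"

primrec sat :: "'p team \<Rightarrow> 'p pt0 \<Rightarrow> bool"  (infix "\<Turnstile>" 50) where
  "X \<Turnstile> Atom a \<longleftrightarrow> atom_sat X a"
| "X \<Turnstile> Conj \<phi> \<psi> \<longleftrightarrow> X \<Turnstile> \<phi> \<and> X \<Turnstile> \<psi>"
| "X \<Turnstile> Tensor \<phi> \<psi> \<longleftrightarrow> (\<exists>Y Z. Y \<subseteq> X \<and> Z \<subseteq> X \<and> X = Y \<union> Z \<and> Y \<Turnstile> \<phi> \<and> Z \<Turnstile> \<psi>)"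
| "X \<Turnstile> IntDisj \<phi> \<psi> \<longleftrightarrow> X \<Turnstile> \<phi> \<or> X \<Turnstile> \<psi>"
| "X \<Turnstile> IntImp \<phi> \<psi> \<longleftrightarrow> (\<forall>Y. Y \<subseteq> X \<longrightarrow> Y \<Turnstile> \<phi> \<longrightarrow> Y \<Turnstile> \<psi>)"

definition pt0_equiv :: "'p pt0 \<Rightarrow> 'p pt0 \<Rightarrow> bool"  (infix "\<equiv>\<^sub>t" 50) where
  "\<phi> \<equiv>\<^sub>t \<psi> \<longleftrightarrow> (\<forall>X. X \<Turnstile> \<phi> \<longleftrightarrow> X \<Turnstile> \<psi>)"

fun is_PD :: "'p pt0 \<Rightarrow> bool" where
  "is_PD (Atom a) \<longleftrightarrow> True"
| "is_PD (Conj \<phi> \<psi>) \<longleftrightarrow> is_PD \<phi> \<and> is_PD \<psi>"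
| "is_PD (Tensor \<phi> \<psi>) \<longleftrightarrow> is_PD \<phi> \<and> is_PD \<psi>"
| "is_PD (IntDisj \<phi> \<psi>) \<longleftrightarrow> False"
| "is_PD (IntImp \<phi> \<psi>) \<longleftrightarrow> False"

text \<open>
  Contexts for PD, with placeholders named by the type \<open>'r\<close>. A placeholder is a separate kind of
  leaf, so it occurs neither negated nor inside a dependence atom. A context need not contain
  every placeholder.
\<close>

datatype ('r, 'p) pd_context =
    Hole 'r
  | CAtom "'p atom"
  | CConj "('r, 'p) pd_context" "('r, 'p) pd_context"
  | CTensor "('r, 'p) pd_context" "('r, 'p) pd_context"

primrec fill :: "('r, 'p) pd_context \<Rightarrow> ('r \<Rightarrow> 'p pt0) \<Rightarrow> 'p pt0" where
  "fill (Hole r) \<theta> = \<theta> r"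
| "fill (CAtom a) \<theta> = Atom a"
| "fill (CConj \<phi> \<psi>) \<theta> = Conj (fill \<phi> \<theta>) (fill \<psi> \<theta>)"
| "fill (CTensor \<phi> \<psi>) \<theta> = Tensor (fill \<phi> \<theta>) (fill \<psi> \<theta>)"

lemma is_PD_fill: "(\<And>r. is_PD (\<theta> r)) \<Longrightarrow> is_PD (fill \<phi> \<theta>)"
  by (induction \<phi>) auto

datatype two = R1 | R2

definition fill2 :: "(two, 'p) pd_context \<Rightarrow> 'p pt0 \<Rightarrow> 'p pt0 \<Rightarrow> 'p pt0" where
  "fill2 \<phi> \<theta>\<^sub>1 \<theta>\<^sub>2 = fill \<phi> (\<lambda>r. case r of R1 \<Rightarrow> \<theta>\<^sub>1 | R2 \<Rightarrow> \<theta>\<^sub>2)"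

end

theory Submission
  imports Defs
begin

text \<open>
  Suppose that a context \<open>\<phi>\<close> defined \<open>\<or>\<close>. Take a team \<open>X = {v, w}\<close> whose two valuations differ at a
  variable \<open>p\<close>. Since \<open>\<top> \<or> \<bottom>\<close> and \<open>\<bottom> \<or> \<top>\<close> are valid, \<open>X\<close> satisfies both \<open>\<phi>[\<top>, \<bottom>]\<close> and
  \<open>\<phi>[\<bottom>, \<top>]\<close>. The constancy atom \<open>=(p)\<close> fails on \<open>X\<close>, and hence so does \<open>=(p) \<or> =(p)\<close>; but it
  holds on every proper subteam of \<open>X\<close>. The proof shows that \<open>X\<close> nevertheless satisfies
  \<open>\<phi>[=(p), =(p)]\<close>, a contradiction.

  The reason is that \<open>\<and>\<close> and \<open>\<otimes>\<close> cannot choose between two alternatives on the whole of \<open>X\<close> without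
  offering a splitting of \<open>X\<close>. No single placeholder can be what makes \<open>\<phi>\<close> true on \<open>X\<close> in both
  instances, as it is \<open>\<bottom>\<close> in one of them. So somewhere \<open>\<phi>\<close> has a tensor that is satisfied either by
  splitting \<open>X\<close> properly, or by its left part alone in one instance and its right part alone in the
  other. In the second situation \<open>X\<close> can be split too, because by downward closure each part of
  the tensor is satisfied by every proper subteam. On proper subteams \<open>=(p)\<close> is as good as
  \<open>\<top>\<close>. This is the content of lemma \<open>sat_fill_combine\<close>.
\<close>

lemma atom_sat_downward_closed:
  assumes "atom_sat X a" and "Y \<subseteq> X"
  shows "atom_sat Y a"
proof (cases a)
  case (Dep ps q)
  have "v q = v' q" if "v \<in> Y" "v' \<in> Y" "\<forall>p\<in>set ps. v p = v' p" for v v'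
  proof -
    have "v \<in> X" "v' \<in> X"
      using that(1,2) assms(2) by blast+
    then show ?thesis
      using assms(1) that(3) unfolding Dep by simp
  qed
  then show ?thesis
    unfolding Dep by simp
qed (use assms in auto)

lemma sat_TensorI:
  assumes "X = A \<union> B" "A \<Turnstile> \<phi>" "B \<Turnstile> \<psi>"
  shows "X \<Turnstile> Tensor \<phi> \<psi>"
  unfolding sat.simps by (intro exI[of _ A] exI[of _ B]) (simp add: assms)

lemma sat_TensorE:
  assumes "X \<Turnstile> Tensor \<phi> \<psi>"
  obtains A B where "X = A \<union> B" "A \<Turnstile> \<phi>" "B \<Turnstile> \<psi>"
  using assms unfolding sat.simps by blast

lemma sat_downward_closed: "X \<Turnstile> \<phi> \<Longrightarrow> Y \<subseteq> X \<Longrightarrow> Y \<Turnstile> \<phi>"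
proof (induction \<phi> arbitrary: X Y)
  case (Atom a)
  then show ?case
    unfolding sat.simps by (rule atom_sat_downward_closed)
next
  case (Conj \<phi> \<psi>)
  from Conj.prems(1) have "X \<Turnstile> \<phi>" "X \<Turnstile> \<psi>"
    by simp_all
  then show ?case
    using Conj.IH[OF _ Conj.prems(2)] by simp
next
  case (Tensor \<phi> \<psi>)
  from Tensor.prems(1) obtain A B where AB: "X = A \<union> B" "A \<Turnstile> \<phi>" "B \<Turnstile> \<psi>"
    by (rule sat_TensorE)
  show ?case
  proof (rule sat_TensorI)
    show "Y = (Y \<inter> A) \<union> (Y \<inter> B)"
      using AB(1) Tensor.prems(2) by blast
    show "Y \<inter> A \<Turnstile> \<phi>"
      using AB(2) by (rule Tensor.IH(1)) (rule Int_lower2)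
    show "Y \<inter> B \<Turnstile> \<psi>"
      using AB(3) by (rule Tensor.IH(2)) (rule Int_lower2)
  qed
next
  case (IntDisj \<phi> \<psi>)
  from IntDisj.prems(1) have "X \<Turnstile> \<phi> \<or> X \<Turnstile> \<psi>"
    by simp
  then show ?case
    using IntDisj.IH[OF _ IntDisj.prems(2)] by auto
next
  case (IntImp \<phi> \<psi>)
  have "Z \<Turnstile> \<psi>" if "Z \<subseteq> Y" "Z \<Turnstile> \<phi>" for Z
    using IntImp.prems(1) subset_trans[OF that(1) IntImp.prems(2)] that(2) by simp
  then show ?case by simp
qed

text \<open>
  Placeholders occur only positively, and evaluating a context on \<open>X\<close> only ever consults subteams
  of \<open>X\<close>; so an entailment between the fillings that is valid below \<open>X\<close> suffices.
\<close>

lemma sat_fill_mono: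
  assumes "X \<Turnstile> fill \<phi> \<theta>" and "\<And>r Y. Y \<subseteq> X \<Longrightarrow> Y \<Turnstile> \<theta> r \<Longrightarrow> Y \<Turnstile> \<theta>' r"
  shows "X \<Turnstile> fill \<phi> \<theta>'"
  using assms
proof (induction \<phi> arbitrary: X)
  case (Hole r)
  from Hole.prems(2)[OF subset_refl] Hole.prems(1) show ?case
    unfolding fill.simps .
next
  case (CAtom a)
  from CAtom.prems(1) show ?case
    unfolding fill.simps .
next
  case (CConj \<phi> \<psi>)
  from CConj.prems(1) have "X \<Turnstile> fill \<phi> \<theta>" "X \<Turnstile> fill \<psi> \<theta>"
    by simp_all
  then show ?case
    unfolding fill.simps sat.simps by (intro conjI CConj.IH CConj.prems(2))
next
  case (CTensor \<phi> \<psi>)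
  from CTensor.prems(1) obtain A B
    where AB: "X = A \<union> B" and "A \<Turnstile> fill \<phi> \<theta>" "B \<Turnstile> fill \<psi> \<theta>"
    unfolding fill.simps by (rule sat_TensorE)
  have below: "Y \<Turnstile> \<theta>' r" if "Y \<subseteq> A \<or> Y \<subseteq> B" "Y \<Turnstile> \<theta> r" for Y r
  proof (rule CTensor.prems(2)[OF _ that(2)])
    show "Y \<subseteq> X"
      using that(1) AB by blast
  qed
  have "A \<Turnstile> fill \<phi> \<theta>'"
    using \<open>A \<Turnstile> fill \<phi> \<theta>\<close> by (rule CTensor.IH(1)) (rule below[OF disjI1])
  moreover have "B \<Turnstile> fill \<psi> \<theta>'"
    using \<open>B \<Turnstile> fill \<psi> \<theta>\<close> by (rule CTensor.IH(2)) (rule below[OF disjI2])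
  ultimately show ?case
    unfolding fill.simps by (rule sat_TensorI[OF AB])
qed

text \<open>
  The fillings \<open>\<theta>\<close> and \<open>\<theta>'\<close> play the roles of \<open>(\<top>, \<bottom>)\<close> and \<open>(\<bottom>, \<top>)\<close>, and \<open>\<eta>\<close> that of \<open>(=(p), =(p))\<close>.
  The induction goes through because at a tensor, a failure to split \<open>X\<close> properly puts all
  of \<open>X\<close> on one side: if this is the same side for \<open>\<theta>\<close> and \<open>\<theta>'\<close>, the induction hypothesis applies
  there, and if the sides are opposite, the cover \<open>X = A \<union> B\<close> provides a proper splitting.
\<close>

lemma sat_fill_combine:
  assumes cover: "X = A \<union> B" "A \<noteq> X" "B \<noteq> X"
    and \<eta>: "\<And>r Y. Y \<subset> X \<Longrightarrow> Y \<Turnstile> \<eta> r"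
    and never_both: "\<And>r. \<not> (X \<Turnstile> \<theta> r \<and> X \<Turnstile> \<theta>' r)"
  shows "X \<Turnstile> fill \<phi> \<theta> \<Longrightarrow> X \<Turnstile> fill \<phi> \<theta>' \<Longrightarrow> X \<Turnstile> fill \<phi> \<eta>"
proof (induction \<phi>)
  case (Hole r)
  then show ?case using never_both by auto
next
  case (CAtom a)
  then show ?case by simp
next
  case (CConj \<phi> \<psi>)
  then show ?case by simp
next
  case (CTensor \<phi> \<psi>)
  have proper: "Y \<Turnstile> fill \<chi> \<eta>" if "Z \<Turnstile> fill \<chi> \<zeta>" "Y \<subseteq> Z" "Y \<subset> X" for Y Z \<chi> \<zeta>
  proof (rule sat_fill_mono)
    show "Y \<Turnstile> fill \<chi> \<zeta>"
      using that(1,2) by (rule sat_downward_closed)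
    show "Y' \<Turnstile> \<eta> r" if "Y' \<subseteq> Y" for r Y'
      by (rule \<eta>) (rule subset_psubset_trans[OF that \<open>Y \<subset> X\<close>])
  qed
  have left: ?case if "X \<Turnstile> fill \<phi> \<eta>" "Z \<Turnstile> fill \<psi> \<zeta>" for Z \<zeta>
  proof -
    have "{} \<Turnstile> fill \<psi> \<eta>"
      by (rule proper[OF that(2)]) (use cover in auto)
    with that(1) show ?thesis
      unfolding fill.simps by (intro sat_TensorI[of X X "{}"]) simp_all
  qed
  have right: ?case if "X \<Turnstile> fill \<psi> \<eta>" "Z \<Turnstile> fill \<phi> \<zeta>" for Z \<zeta>
  proof -
    have "{} \<Turnstile> fill \<phi> \<eta>"
      by (rule proper[OF that(2)]) (use cover in auto)
    with that(1) show ?thesis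
      unfolding fill.simps by (intro sat_TensorI[of X "{}" X]) simp_all
  qed
  have split: ?case if "X = Y \<union> Z" "Y \<noteq> X" "Z \<noteq> X"
      "Y' \<Turnstile> fill \<phi> \<zeta>" "Y \<subseteq> Y'" "Z' \<Turnstile> fill \<psi> \<zeta>'" "Z \<subseteq> Z'" for Y Y' Z Z' \<zeta> \<zeta>'
  proof -
    have "Y \<subset> X" "Z \<subset> X"
      using that(1-3) by blast+
    then have "Y \<Turnstile> fill \<phi> \<eta>" "Z \<Turnstile> fill \<psi> \<eta>"
      by (auto intro: proper[OF that(4,5)] proper[OF that(6,7)])
    with that(1) show ?thesis
      unfolding fill.simps by (rule sat_TensorI)
  qed
  obtain Y Z where YZ: "X = Y \<union> Z" "Y \<Turnstile> fill \<phi> \<theta>" "Z \<Turnstile> fill \<psi> \<theta>"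
    using CTensor.prems(1) unfolding fill.simps by (rule sat_TensorE)
  obtain Y' Z' where YZ': "X = Y' \<union> Z'" "Y' \<Turnstile> fill \<phi> \<theta>'" "Z' \<Turnstile> fill \<psi> \<theta>'"
    using CTensor.prems(2) unfolding fill.simps by (rule sat_TensorE)
  consider "Y \<noteq> X" "Z \<noteq> X" | "Y' \<noteq> X" "Z' \<noteq> X" | "Y = X" "Y' = X" | "Z = X" "Z' = X"
    | "Y = X" "Z' = X" | "Z = X" "Y' = X"
    by blast
  then show ?case
  proof cases
    case 1
    show ?thesis
      by (rule split[OF YZ(1) 1 YZ(2) subset_refl YZ(3) subset_refl])
  next
    case 2
    show ?thesis
      by (rule split[OF YZ'(1) 2 YZ'(2) subset_refl YZ'(3) subset_refl])
  next
    case 3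
    then have "X \<Turnstile> fill \<phi> \<eta>"
      using CTensor.IH(1) YZ(2) YZ'(2) by blast
    then show ?thesis
      by (rule left) (rule YZ(3))
  next
    case 4
    then have "X \<Turnstile> fill \<psi> \<eta>"
      using CTensor.IH(2) YZ(3) YZ'(3) by blast
    then show ?thesis
      by (rule right) (rule YZ(2))
  next
    case 5
    then have "A \<subseteq> Y" "B \<subseteq> Z'"
      using cover(1) by blast+
    then show ?thesis
      by (intro split[OF cover YZ(2) _ YZ'(3)])
  next
    case 6
    then have "A \<subseteq> Y'" "B \<subseteq> Z"
      using cover(1) by blast+
    then show ?thesis
      by (intro split[OF cover YZ'(2) _ YZ(3)])
  qed
qed

theorem theorem5p7:
  shows "\<not> (\<exists>\<phi> :: (two, 'p) pd_context. \<forall>\<theta>\<^sub>1 \<theta>\<^sub>2 :: 'p pt0.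
           is_PD \<theta>\<^sub>1 \<longrightarrow> is_PD \<theta>\<^sub>2 \<longrightarrow> fill2 \<phi> \<theta>\<^sub>1 \<theta>\<^sub>2 \<equiv>\<^sub>t IntDisj \<theta>\<^sub>1 \<theta>\<^sub>2)"
proof
  assume "\<exists>\<phi> :: (two, 'p) pd_context. \<forall>\<theta>\<^sub>1 \<theta>\<^sub>2 :: 'p pt0.
           is_PD \<theta>\<^sub>1 \<longrightarrow> is_PD \<theta>\<^sub>2 \<longrightarrow> fill2 \<phi> \<theta>\<^sub>1 \<theta>\<^sub>2 \<equiv>\<^sub>t IntDisj \<theta>\<^sub>1 \<theta>\<^sub>2"
  then obtain \<phi> :: "(two, 'p) pd_context" where defines_disj: "\<forall>\<theta>\<^sub>1 \<theta>\<^sub>2. is_PD \<theta>\<^sub>1 \<longrightarrow> is_PD \<theta>\<^sub>2 \<longrightarrow>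
      fill2 \<phi> \<theta>\<^sub>1 \<theta>\<^sub>2 \<equiv>\<^sub>t IntDisj \<theta>\<^sub>1 \<theta>\<^sub>2"
    by (rule exE)
  have \<phi>: "X \<Turnstile> fill \<phi> (case_two (Atom a) (Atom b)) \<longleftrightarrow> X \<Turnstile> Atom a \<or> X \<Turnstile> Atom b" for X a b
  proof -
    have "fill2 \<phi> (Atom a) (Atom b) \<equiv>\<^sub>t IntDisj (Atom a) (Atom b)"
      by (rule defines_disj[rule_format]) simp_all
    then have "X \<Turnstile> fill2 \<phi> (Atom a) (Atom b) \<longleftrightarrow> X \<Turnstile> IntDisj (Atom a) (Atom b)"
      unfolding pt0_equiv_def by (rule spec)
    then show ?thesis
      unfolding fill2_def sat.simps(4) .
  qed
  fix p :: 'p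
  define v w :: "'p valuation" where "v = (\<lambda>_. True)" and "w = (\<lambda>_. False)"
  define X where "X = {v, w}"
  \<comment> \<open>\<open>=(p, p)\<close> serves as \<open>\<top>\<close>, which is not among the atoms.\<close>
  define D top bot :: "'p pt0"
    where "D = Atom (Dep [] p)" and "top = Atom (Dep [p] p)" and "bot = Atom Bot"
  have "\<not> v p = w p" and "v \<noteq> w"
    by (simp_all add: v_def w_def fun_eq_iff)
  have top: "Y \<Turnstile> top" for Y
    unfolding top_def by simp
  have bot: "\<not> X \<Turnstile> bot"
    unfolding bot_def X_def by simp
  have D_X: "\<not> X \<Turnstile> D"
    using \<open>\<not> v p = w p\<close> unfolding D_def X_def by simp
  have D_proper: "Y \<Turnstile> D" if "Y \<subset> X" for Y
  proof -
    have "Y \<subseteq> {v} \<or> Y \<subseteq> {w}"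
      using that unfolding X_def by blast
    moreover have "{u} \<Turnstile> D" for u
      unfolding D_def by simp
    ultimately show ?thesis
      using sat_downward_closed by blast
  qed
  have "X \<Turnstile> fill \<phi> (case_two D D)"
  proof (rule sat_fill_combine)
    show "X = {v} \<union> {w}" "{v} \<noteq> X" "{w} \<noteq> X"
      using \<open>v \<noteq> w\<close> unfolding X_def by auto
    show "Y \<Turnstile> case_two D D r" if "Y \<subset> X" for Y r
      using D_proper[OF that] by (cases r) simp_all
    show "\<not> (X \<Turnstile> case_two top bot r \<and> X \<Turnstile> case_two bot top r)" for r
      using bot by (cases r) simp_all
    show "X \<Turnstile> fill \<phi> (case_two top bot)"
      using top[of X] unfolding top_def bot_def \<phi> by (rule disjI1)
    show "X \<Turnstile> fill \<phi> (case_two bot top)"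
      using top[of X] unfolding top_def bot_def \<phi> by (rule disjI2)
  qed
  then have "X \<Turnstile> D"
    unfolding D_def \<phi> by simp
  with D_X show False
    by (rule notE)
qed

end
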